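(* Let $n\geq 5$ and let $\overrightarrow{G}$ be a nontrivial weakly connected spanning closed subgraph of $\overrightarrow{C_n^2}$. Then there exist integers $j,k$ with $0\leq j\leq n-1$ and $0\leq k\leq\lceil\frac{n-2}{2}\rceil$ such that $\overrightarrow{G}=\overrightarrow{S_{n,k,j}}$.
   Context: For $n\geq 5$, the directed square cycle $\overrightarrow{C_n^2}$ has vertex set $\mathbb{Z}_n$, writing $v_i=i+n\mathbb{Z}$ for $i\in\mathbb{Z}$ (indices modulo $n$), and edges $e_i=(v_i,v_{i+1})$ (frames) and $f_i=(v_i,v_{i+2})$ (windows), $i\in\mathbb{Z}$. A spanning subgraph has vertex set $\mathbb{Z}_n$ and a subset of the edges; it is weakly connected if its underlying undirected graph is connected. The triangle $T_i$ is $\{e_i,e_{i+1},f_i\}$; a subgraph $\overrightarrow{G}$ is closed if for every $i$, $|T_i\cap E(\overrightarrow{G})|\leq 1$ or $T_i\subseteq E(\overrightarrow{G})$. The trivial weakly connected spanning closed subgraphs are $\overrightarrow{C_n^2}$ itself and, when $n$ is odd, the subgraph whose edges are all the windows $f_0,\dots,f_{n-1}$; all others are nontrivial. For integers $j,k$ with $0\leq k\leq\lceil\frac{n-2}{2}\rceil$, $\overrightarrow{S_{n,k,j}}$ is the spanning subgraph of $\overrightarrow{C_n^2}$ with edge set $E(\overrightarrow{C_n^2})\setminus\big(\{f_{j-2},f_{j+2k-1}\}\cup\{e_{j-1},e_j,\dots,e_{j+2k-1}\}\big)$. *)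

theory Defs
  imports Complex_Main "Graph_Theory.Graph_Theory"
begin

text \<open>
  The ring of integers modulo \<open>n\<close> is represented by the residues \<open>{0..<int n}\<close>. An edge is the pair
  of its tail and its head; for \<open>n \<ge> 5\<close> the \<open>2 * n\<close> frames and windows are pairwise distinct pairs.
\<close>

definition vtx :: "nat \<Rightarrow> int \<Rightarrow> int" where
  "vtx n i = i mod int n"

definition frame :: "nat \<Rightarrow> int \<Rightarrow> int \<times> int" where
  "frame n i = (vtx n i, vtx n (i + 1))"

definition window :: "nat \<Rightarrow> int \<Rightarrow> int \<times> int" where
  "window n i = (vtx n i, vtx n (i + 2))"

definition square_cycle :: "nat \<Rightarrow> int pair_pre_digraph" where
  "square_cycle n = \<lparr>pverts = {0..<int n}, parcs = range (frame n) \<union> range (window n)\<rparr>"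

definition triangle :: "nat \<Rightarrow> int \<Rightarrow> (int \<times> int) set" where
  "triangle n i = {frame n i, frame n (i + 1), window n i}"

definition closed_subgraph :: "nat \<Rightarrow> int pair_pre_digraph \<Rightarrow> bool" where
  "closed_subgraph n G \<longleftrightarrow>
     (\<forall>i. card (triangle n i \<inter> parcs G) \<le> 1 \<or> triangle n i \<subseteq> parcs G)"

text \<open>
  \<^const>\<open>Digraph_Component.connected\<close> is connectedness of the underlying undirected graph. It is
  written qualified because \<open>connected\<close> is also a predicate on topological spaces.
\<close>

definition wcs_closed :: "nat \<Rightarrow> int pair_pre_digraph \<Rightarrow> bool" where
  "wcs_closed n G \<longleftrightarrow>
     spanning (with_proj G) (with_proj (square_cycle n)) \<and>
     Digraph_Component.connected (with_proj G) \<and>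
     closed_subgraph n G"

definition windows_graph :: "nat \<Rightarrow> int pair_pre_digraph" where
  "windows_graph n = \<lparr>pverts = {0..<int n}, parcs = range (window n)\<rparr>"

definition trivial_wcs_closed :: "nat \<Rightarrow> int pair_pre_digraph \<Rightarrow> bool" where
  "trivial_wcs_closed n G \<longleftrightarrow> G = square_cycle n \<or> (odd n \<and> G = windows_graph n)"

definition S_graph :: "nat \<Rightarrow> int \<Rightarrow> int \<Rightarrow> int pair_pre_digraph" where
  "S_graph n k j =
     \<lparr>pverts = {0..<int n},
      parcs = parcs (square_cycle n) -
        ({window n (j - 2), window n (j + 2 * k - 1)} \<union> frame n ` {j - 1..j + 2 * k - 1})\<rparr>"

end

theory Submission
  imports Defs
begin

text \<open>
  Weak connectedness is only used through cuts: a set of integers that is closed under every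
  step along a present edge, in either direction, meets every residue class. At the ends of a
  maximal run \<open>a, \<dots>, b\<close> of missing frames the triangles force the windows
  \<open>a - 1\<close> and \<open>b\<close> to be missing. If the run had even length, if a further window with
  index in \<open>{a..<b}\<close> were missing, or if there were a second run, then a suitable set made of
  arithmetic progressions of difference 2 (and the interval between two runs) would violate the
  cut property. Hence there is at most one run and the graph is determined by it.
  If all frames are missing, then \<open>n\<close> is odd and the windows form a single cycle, from which
  at most one edge can be missing.
\<close>

section \<open>Residue classes and the distinctness of edges\<close>

lemma vtx_eq_iff: "vtx n i = vtx n j \<longleftrightarrow> int n dvd i - j"
  by (simp add: vtx_def mod_eq_dvd_iff)

lemma vtx_shift: "vtx n i = vtx n j \<Longrightarrow> vtx n (i + d) = vtx n (j + d)"
  by (simp add: vtx_eq_iff)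

lemma vtx_in_verts: "n > 0 \<Longrightarrow> vtx n i \<in> {0..<int n}"
  by (simp add: vtx_def)

lemma vtx_eq_imp_eq:
  assumes "vtx n i = vtx n j" "\<bar>i - j\<bar> < int n"
  shows "i = j"
  using assms dvd_imp_le_int[of "i - j" "int n"] by (force simp: vtx_eq_iff)

text \<open>The offset \<open>a\<close> is free so that each use can choose the block of
  \<open>n\<close> consecutive integers in which it works.\<close>

lemma vtx_representative:
  assumes "n > 0"
  obtains i' where "vtx n i' = vtx n i" "a \<le> i'" "i' < a + int n"
proof
  show "vtx n (a + (i - a) mod int n) = vtx n i"
    by (simp add: vtx_def mod_simps)
qed (use assms in auto)

lemma frame_eq_iff: "frame n i = frame n j \<longleftrightarrow> vtx n i = vtx n j"
  by (auto simp: frame_def vtx_eq_iff)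

lemma window_eq_iff: "window n i = window n j \<longleftrightarrow> vtx n i = vtx n j"
  by (auto simp: window_def vtx_eq_iff)

text \<open>Equal tails and equal heads give two divisibilities whose difference says that
  \<open>n\<close> divides 1.\<close>

lemma frame_neq_window:
  assumes "n \<ge> 2"
  shows "frame n i \<noteq> window n j"
proof
  assume "frame n i = window n j"
  then have "int n dvd i - j" "int n dvd (i + 1) - (j + 2)"
    by (auto simp: frame_def window_def vtx_eq_iff)
  then have "int n dvd (i - j) - ((i + 1) - (j + 2))"
    by (rule dvd_diff)
  with assms show False
    by simp
qed

lemma int_first_satisfying:
  fixes P :: "int \<Rightarrow> bool"
  assumes "P c" "a \<le> c"
  shows "\<exists>b. a \<le> b \<and> b \<le> c \<and> P b \<and> (\<forall>i. a \<le> i \<longrightarrow> i < b \<longrightarrow> \<not> P i)"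
proof -
  define m where "m = (LEAST m. P (a + int m))"
  have ex: "P (a + int (nat (c - a)))"
    using assms by simp
  have "P (a + int m)"
    unfolding m_def using ex by (rule LeastI)
  moreover have "m \<le> nat (c - a)"
    unfolding m_def using ex by (rule Least_le)
  moreover have "\<not> P i" if "a \<le> i" "i < a + int m" for i
  proof
    assume "P i"
    then have "m \<le> nat (i - a)"
      unfolding m_def using that by (intro Least_le) simp
    with that show False
      by simp
  qed
  ultimately show ?thesis
    using assms by (intro exI[of _ "a + int m"]) auto
qed

section \<open>Closedness and weak connectedness in terms of integer indices\<close>

locale closed_spanning_subgraph =
  fixes n :: nat and G :: "int pair_pre_digraph"
  assumes n_ge: "n \<ge> 5" and wcs: "wcs_closed n G"
begin

abbreviation has_frame :: "int \<Rightarrow> bool" where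
  "has_frame i \<equiv> frame n i \<in> parcs G"

abbreviation has_window :: "int \<Rightarrow> bool" where
  "has_window i \<equiv> window n i \<in> parcs G"

lemma pverts_G: "pverts G = {0..<int n}"
  using wcs by (simp add: wcs_closed_def spanning_def square_cycle_def)

lemma parcs_G: "parcs G \<subseteq> range (frame n) \<union> range (window n)"
  using wcs by (simp add: wcs_closed_def spanning_def subgraph_def square_cycle_def)

lemma has_frame_cong: "vtx n i = vtx n j \<Longrightarrow> has_frame i \<longleftrightarrow> has_frame j"
  by (metis frame_eq_iff)

lemma has_window_cong: "vtx n i = vtx n j \<Longrightarrow> has_window i \<longleftrightarrow> has_window j"
  by (metis window_eq_iff)

lemma has_frame_period [simp]: "has_frame (i + int n) \<longleftrightarrow> has_frame i"
  by (rule has_frame_cong) (simp add: vtx_eq_iff)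

lemma has_window_period [simp]: "has_window (i + int n) \<longleftrightarrow> has_window i"
  by (rule has_window_cong) (simp add: vtx_eq_iff)

text \<open>The three edges of a triangle are distinct, so two of them in \<open>G\<close> push the
  cardinality above 1 and force the third.\<close>

lemma triangle_closed:
  shows "has_frame i \<Longrightarrow> has_frame (i + 1) \<Longrightarrow> has_window i"
    and "has_frame i \<Longrightarrow> has_window i \<Longrightarrow> has_frame (i + 1)"
    and "has_frame (i + 1) \<Longrightarrow> has_window i \<Longrightarrow> has_frame i"
proof -
  have distinct: "frame n i \<noteq> frame n (i + 1)" "frame n i \<noteq> window n i"
    "frame n (i + 1) \<noteq> window n i"
    using n_ge frame_neq_window[of n] vtx_eq_imp_eq[of n i "i + 1"] by (auto simp: frame_eq_iff)
  have all: "triangle n i \<subseteq> parcs G"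
    if "{x, y} \<subseteq> triangle n i \<inter> parcs G" "x \<noteq> y" for x y
  proof -
    have "finite (triangle n i \<inter> parcs G)"
      by (simp add: triangle_def)
    from card_mono[OF this that(1)] that(2) have "\<not> card (triangle n i \<inter> parcs G) \<le> 1"
      by simp
    then show ?thesis
      using wcs by (auto simp: wcs_closed_def closed_subgraph_def)
  qed
  show "has_window i" if "has_frame i" "has_frame (i + 1)"
    using all[of "frame n i" "frame n (i + 1)"] distinct that by (simp add: triangle_def)
  show "has_frame (i + 1)" if "has_frame i" "has_window i"
    using all[of "frame n i" "window n i"] distinct that by (simp add: triangle_def)
  show "has_frame i" if "has_frame (i + 1)" "has_window i"
    using all[of "frame n (i + 1)" "window n i"] distinct that by (simp add: triangle_def)
qed

text \<open>Induction along an undirected walk from a point of \<open>X\<close>: each edge is lifted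
  to a step by 1 or 2 from the integer representative already found in \<open>X\<close>. Since
  \<open>X\<close> consists of integers, it need not be a union of residue classes.\<close>

lemma cut:
  assumes "X \<noteq> {}"
    and frame_fwd: "\<And>x. x \<in> X \<Longrightarrow> has_frame x \<Longrightarrow> x + 1 \<in> X"
    and frame_bwd: "\<And>x. x \<in> X \<Longrightarrow> has_frame (x - 1) \<Longrightarrow> x - 1 \<in> X"
    and window_fwd: "\<And>x. x \<in> X \<Longrightarrow> has_window x \<Longrightarrow> x + 2 \<in> X"
    and window_bwd: "\<And>x. x \<in> X \<Longrightarrow> has_window (x - 2) \<Longrightarrow> x - 2 \<in> X"
  shows "\<exists>x\<in>X. vtx n x = vtx n y"
proof -
  from assms(1) obtain x0 where "x0 \<in> X"
    by blast
  have "(vtx n x0, vtx n y) \<in> rtrancl_on (pverts G) (parcs (mk_symmetric (with_proj G)))"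
    using wcs vtx_in_verts[of n] n_ge
    by (auto simp: wcs_closed_def Digraph_Component.connected_def strongly_connected_def
        reachable_def pverts_G)
  then show ?thesis
  proof (induction "vtx n x0" "vtx n y" arbitrary: y)
    case rtrancl_on_refl
    then show ?case
      using \<open>x0 \<in> X\<close> by metis
  next
    case (rtrancl_on_into_rtrancl_on b)
    have "b \<in> {0..<int n}"
      using rtrancl_on_into_rtrancl_on.hyps(1) by (auto simp: pverts_G dest: in_rtrancl_on_in_F)
    then have "b = vtx n b"
      by (simp add: vtx_def)
    then obtain x where x: "x \<in> X" "vtx n x = b"
      using rtrancl_on_into_rtrancl_on.hyps(2) by metis
    have "(b, vtx n y) \<in> parcs G \<or> (vtx n y, b) \<in> parcs G"
      using rtrancl_on_into_rtrancl_on.hyps(3) by (auto simp: parcs_mk_symmetric)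
    then show ?case
    proof
      assume e: "(b, vtx n y) \<in> parcs G"
      with parcs_G consider i where "(b, vtx n y) = frame n i" | i where "(b, vtx n y) = window n i"
        by blast
      then show ?thesis
      proof cases
        case 1
        with x have *: "vtx n x = vtx n i" "vtx n y = vtx n (i + 1)"
          by (auto simp: frame_def)
        with e 1 x frame_fwd[of x] has_frame_cong[of x i] have "x + 1 \<in> X"
          by simp
        with * show ?thesis
          by (intro bexI[of _ "x + 1"]) (simp_all add: vtx_shift[of n x i])
      next
        case 2
        with x have *: "vtx n x = vtx n i" "vtx n y = vtx n (i + 2)"
          by (auto simp: window_def)
        with e 2 x window_fwd[of x] has_window_cong[of x i] have "x + 2 \<in> X"
          by simp
        with * show ?thesis
          by (intro bexI[of _ "x + 2"]) (simp_all add: vtx_shift[of n x i])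
      qed
    next
      assume e: "(vtx n y, b) \<in> parcs G"
      with parcs_G consider i where "(vtx n y, b) = frame n i" | i where "(vtx n y, b) = window n i"
        by blast
      then show ?thesis
      proof cases
        case 1
        with x have *: "vtx n (x - 1) = vtx n i" "vtx n y = vtx n i"
          by (auto simp: frame_def vtx_eq_iff algebra_simps)
        with e 1 x frame_bwd[of x] has_frame_cong[of "x - 1" i] have "x - 1 \<in> X"
          by simp
        with * show ?thesis
          by (intro bexI[of _ "x - 1"]) simp_all
      next
        case 2
        with x have *: "vtx n (x - 2) = vtx n i" "vtx n y = vtx n i"
          by (auto simp: window_def vtx_eq_iff algebra_simps)
        with e 2 x window_bwd[of x] has_window_cong[of "x - 2" i] have "x - 2 \<in> X"
          by simp
        with * show ?thesis
          by (intro bexI[of _ "x - 2"]) simp_all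
      qed
    qed
  qed
qed

section \<open>Identifying \<open>G\<close> from its frames and windows\<close>

lemma eq_square_cycleI:
  assumes "\<And>i. has_frame i" "\<And>i. has_window i"
  shows "G = square_cycle n"
proof -
  have "parcs G = parcs (square_cycle n)"
    using parcs_G assms by (auto simp: square_cycle_def)
  then show ?thesis
    by (simp add: square_cycle_def pverts_G)
qed

lemma eq_windows_graphI:
  assumes "\<And>i. \<not> has_frame i" "\<And>i. has_window i"
  shows "G = windows_graph n"
proof -
  have "parcs G = parcs (windows_graph n)"
    using parcs_G assms by (auto simp: windows_graph_def)
  then show ?thesis
    by (simp add: windows_graph_def pverts_G)
qed

text \<open>No frame is a window, so the two kinds of deleted edges can be compared
  separately.\<close>

lemma eq_S_graphI:
  assumes "\<And>i. has_frame i \<longleftrightarrow> (\<forall>t\<in>{j - 1..j + 2 * k - 1}. vtx n i \<noteq> vtx n t)"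
    and "\<And>i. has_window i \<longleftrightarrow> vtx n i \<noteq> vtx n (j - 2) \<and> vtx n i \<noteq> vtx n (j + 2 * k - 1)"
  shows "G = S_graph n k j"
proof -
  have neq: "frame n i \<noteq> window n i'" for i i'
    using n_ge frame_neq_window by simp
  have "e \<in> parcs G \<longleftrightarrow> e \<in> parcs (S_graph n k j)" for e
  proof (cases "e \<in> range (frame n) \<union> range (window n)")
    case True
    then consider i where "e = frame n i" | i where "e = window n i"
      by blast
    then show ?thesis
    proof cases
      case 1
      then show ?thesis
        using assms(1)[of i] neq
        by (auto simp: S_graph_def square_cycle_def frame_eq_iff image_iff)
    next
      case 2
      then show ?thesis
        using assms(2)[of i] neq[symmetric]
        by (auto simp: S_graph_def square_cycle_def window_eq_iff image_iff)
    qed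
  next
    case False
    then show ?thesis
      using parcs_G by (auto simp: S_graph_def square_cycle_def)
  qed
  then have "parcs G = parcs (S_graph n k j)"
    by blast
  then show ?thesis
    by (simp add: S_graph_def pverts_G)
qed

section \<open>Runs of missing frames\<close>

text \<open>The set \<open>s, s + 2, ..., t\<close> could be left only through the missing frames or
  through the windows \<open>s - 2\<close> and \<open>t\<close>. The upper bound on \<open>t\<close>
  keeps the class of \<open>s - 1\<close> outside it, which contradicts \<open>cut\<close>.\<close>

lemma no_isolated_progression:
  assumes "s \<le> t" "even (t - s)" "t \<le> s + int n - 2"
    and no_frame: "\<And>i. s - 1 \<le> i \<Longrightarrow> i \<le> t \<Longrightarrow> \<not> has_frame i"
    and no_window: "\<not> has_window (s - 2)" "\<not> has_window t"
  shows False
proof -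
  let ?X = "{x. s \<le> x \<and> x \<le> t \<and> even (x - s)}"
  have "\<exists>x\<in>?X. vtx n x = vtx n (s - 1)"
  proof (rule cut)
    show "?X \<noteq> {}"
      using assms(1) by (auto intro: exI[of _ s])
    show "x + 1 \<in> ?X" if "x \<in> ?X" "has_frame x" for x
      using that no_frame[of x] by simp
    show "x - 1 \<in> ?X" if "x \<in> ?X" "has_frame (x - 1)" for x
      using that no_frame[of "x - 1"] by simp
    show "x + 2 \<in> ?X" if "x \<in> ?X" "has_window x" for x
    proof -
      have "x \<noteq> t"
        using that no_window by auto
      moreover have "x \<noteq> t - 1"
        using that assms(2) by auto
      ultimately show ?thesis
        using that by auto
    qed
    show "x - 2 \<in> ?X" if "x \<in> ?X" "has_window (x - 2)" for x
    proof -
      have "x \<noteq> s"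
        using that no_window by auto
      moreover have "x \<noteq> s + 1"
        using that by auto
      ultimately show ?thesis
        using that by auto
    qed
  qed
  then obtain x where "x \<in> ?X" "vtx n x = vtx n (s - 1)"
    by blast
  with vtx_eq_imp_eq[of n x "s - 1"] assms(3) show False
    by auto
qed

text \<open>The four missing end windows are exactly those that would join the cut set below to its
  complement near the two runs.\<close>

lemma no_two_runs:
  assumes le: "a \<le> b" "b + 2 \<le> a'" "a' \<le> b'" "b' \<le> a + int n - 2"
    and even: "even (b - a)" "even (b' - a')"
    and no_frame: "\<And>i. a \<le> i \<Longrightarrow> i \<le> b \<Longrightarrow> \<not> has_frame i"
      "\<And>i. a' \<le> i \<Longrightarrow> i \<le> b' \<Longrightarrow> \<not> has_frame i"
    and no_window: "\<not> has_window (a - 1)" "\<not> has_window b"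
      "\<not> has_window (a' - 1)" "\<not> has_window b'"
  shows False
proof -
  \<comment> \<open>This is \<open>a + 1, a + 3, ..., b - 1\<close>, then every integer from
    \<open>b + 1\<close> to \<open>a'\<close>, then \<open>a' + 2, a' + 4, ..., b'\<close>. Frames
    can be present only in the middle block, and the class of \<open>a\<close> is avoided.\<close>
  let ?X = "{x. a + 1 \<le> x \<and> x \<le> b' \<and> (x \<le> b \<longrightarrow> odd (x - a)) \<and> (a' < x \<longrightarrow> even (x - a'))}"
  have "\<exists>x\<in>?X. vtx n x = vtx n a"
  proof (rule cut)
    have "a' \<in> ?X"
      using le by auto
    then show "?X \<noteq> {}"
      by blast
    fix x
    assume "x \<in> ?X"
    then have x: "a + 1 \<le> x \<and> x \<le> b' \<and> (x \<le> b \<longrightarrow> odd (x - a)) \<and> (a' < x \<longrightarrow> even (x - a'))"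
      by simp
    show "x + 1 \<in> ?X" if "has_frame x"
    proof -
      have "b < x" "x < a'"
        using that no_frame[of x] x by force+
      then show ?thesis
        using le by simp
    qed
    show "x - 1 \<in> ?X" if "has_frame (x - 1)"
    proof -
      have "b < x - 1" "x - 1 < a'"
        using that no_frame[of "x - 1"] x by force+
      then show ?thesis
        using le by simp
    qed
    show "x + 2 \<in> ?X" if "has_window x"
    proof -
      have ne: "x \<noteq> a' - 1" "x \<noteq> b'" "x \<noteq> b"
        using that no_window by auto
      then consider "x < b" | "b < x" "x < a' - 1" | "b < x" "a' \<le> x"
        by linarith
      then show ?thesis
      proof cases
        case 3
        then have "even (x - a')"
          using x by (cases "x = a'") auto
        with even have "even (b' - x)"
          by auto
        \<comment> \<open>Parity excludes \<open>b' - 1\<close>, the only other point from which a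
          window could jump past \<open>b'\<close>.\<close>
        then have "b' - x \<noteq> 1"
          by (metis odd_one)
        with ne(2) x have "x + 2 \<le> b'"
          by linarith
        with 3 x \<open>even (x - a')\<close> show ?thesis
          by simp
      qed (use x le in auto)
    qed
    show "x - 2 \<in> ?X" if "has_window (x - 2)"
    proof -
      have ne: "x \<noteq> a + 1" "x \<noteq> b + 2" "x \<noteq> a' + 1"
        using that no_window by auto
      then consider "x \<le> b + 1" | "b + 3 \<le> x"
        by linarith
      then show ?thesis
      proof cases
        case 1
        \<comment> \<open>The point \<open>b + 1\<close> of the middle block continues the first
          progression, because \<open>b - a\<close> is even.\<close>
        then have "odd (x - a)"
          using x even(1) by (cases "x = b + 1") auto
        then have "x - a \<noteq> 2"
          by (metis even_numeral)
        with ne(1) x have "a + 1 \<le> x - 2"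
          by linarith
        with 1 x le \<open>odd (x - a)\<close> show ?thesis
          by simp
      next
        case 2
        with x le ne show ?thesis
          by simp
      qed
    qed
  qed
  then obtain x where "x \<in> ?X" "vtx n x = vtx n a"
    by blast
  with vtx_eq_imp_eq[of n x a] le show False
    by auto
qed

text \<open>If \<open>b - a\<close> were odd, \<open>a + 1, a + 3, ..., b\<close> would be isolated.
  A missing window \<open>i\<close> inside the run isolates \<open>i + 2, ..., b\<close> when
  \<open>i - a\<close> is even and \<open>a + 1, ..., i\<close> when it is odd.\<close>

lemma run_even_and_windows:
  assumes "a \<le> b" "b \<le> a + int n - 2"
    and no_frame: "\<And>i. a \<le> i \<Longrightarrow> i \<le> b \<Longrightarrow> \<not> has_frame i"
    and no_window: "\<not> has_window (a - 1)" "\<not> has_window b"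
  shows "even (b - a)" and "\<And>i. a \<le> i \<Longrightarrow> i < b \<Longrightarrow> has_window i"
proof -
  show even: "even (b - a)"
  proof (rule ccontr)
    assume odd: "odd (b - a)"
    then have "a \<noteq> b"
      by auto
    show False
    proof (rule no_isolated_progression[of "a + 1" b])
      show "even (b - (a + 1))"
        using odd by simp
      show "\<not> has_frame i" if "a + 1 - 1 \<le> i" "i \<le> b" for i
        using no_frame that by simp
    qed (use assms \<open>a \<noteq> b\<close> in auto)
  qed
  show "has_window i" if i: "a \<le> i" "i < b" for i
  proof (rule ccontr)
    assume missing: "\<not> has_window i"
    show False
    proof (cases "even (i - a)")
      case True
      then have "even (b - i)"
        using even by simp
      then have "b - i \<noteq> 1"
        by (metis odd_one)
      show False
      proof (rule no_isolated_progression[of "i + 2" b])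
        show "i + 2 \<le> b"
          using \<open>b - i \<noteq> 1\<close> i by simp
        show "even (b - (i + 2))"
          using \<open>even (b - i)\<close> by simp
        show "\<not> has_frame l" if "i + 2 - 1 \<le> l" "l \<le> b" for l
          using no_frame i that by simp
      qed (use assms(2) i missing no_window in auto)
    next
      case False
      then have "i \<noteq> a"
        by auto
      show False
      proof (rule no_isolated_progression[of "a + 1" i])
        show "even (i - (a + 1))"
          using False by simp
        show "\<not> has_frame l" if "a + 1 - 1 \<le> l" "l \<le> i" for l
          using no_frame i that by simp
      qed (use assms(2) i \<open>i \<noteq> a\<close> missing no_window in auto)
    qed
  qed
qed

section \<open>The case without frames\<close>

text \<open>Windows preserve parity, so for even \<open>n\<close> the even integers never reach the
  class of 1.\<close>

lemma no_frames_odd: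
  assumes "\<And>i. \<not> has_frame i"
  shows "odd n"
proof
  assume "even n"
  have "\<exists>x\<in>{x. even x}. vtx n x = vtx n 1"
    using assms by (intro cut) auto
  then obtain x where "even x" "int n dvd x - 1"
    by (auto simp: vtx_eq_iff)
  moreover have "even (int n)"
    using \<open>even n\<close> by simp
  ultimately have "even (x - 1)"
    using dvd_trans by blast
  with \<open>even x\<close> show False
    by simp
qed

text \<open>Two distinct deletions would cut the single cycle of windows into two paths;
  \<open>?X\<close> runs along one of them.\<close>

lemma no_frames_missing_window_unique:
  assumes "\<And>i. \<not> has_frame i" "\<not> has_window c" "\<not> has_window d"
  shows "vtx n c = vtx n d"
proof (rule ccontr)
  assume neq: "vtx n c \<noteq> vtx n d"
  have odd: "odd (int n)"
    using no_frames_odd assms(1) by simp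
  obtain d0 where d0: "vtx n d0 = vtx n d" "c \<le> d0" "d0 < c + int n"
    using vtx_representative[of n d c] n_ge by auto
  with neq have "d0 \<noteq> c"
    by auto
  \<comment> \<open>As \<open>n\<close> is odd, adding it corrects the parity, so the progression of
    difference 2 from \<open>c\<close> hits the class of \<open>d\<close> at \<open>e\<close> within
    two periods.\<close>
  define e where "e = (if even (d0 - c) then d0 else d0 + int n)"
  have even_e: "even (e - c)"
    using odd by (auto simp: e_def)
  have e_bounds: "c < e" "e < c + 2 * int n"
    using d0 \<open>d0 \<noteq> c\<close> by (auto simp: e_def)
  then have e_bounds': "c + 2 \<le> e"
    using even_e by (cases "e = c + 1") auto
  have no_window: "\<not> has_window e"
    using d0 assms(3) has_window_cong[of d0 d] by (simp add: e_def)
  let ?X = "{x. c + 2 \<le> x \<and> x \<le> e \<and> even (x - c)}"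
  have "\<exists>x\<in>?X. vtx n x = vtx n c"
  proof (rule cut)
    show "?X \<noteq> {}"
      using e_bounds' even_e by blast
    show "x + 2 \<in> ?X" if "x \<in> ?X" "has_window x" for x
    proof -
      have "x \<noteq> e" "x \<noteq> e - 1"
        using that no_window even_e by auto
      then show ?thesis
        using that by auto
    qed
    show "x - 2 \<in> ?X" if "x \<in> ?X" "has_window (x - 2)" for x
    proof -
      have "x \<noteq> c + 2" "x \<noteq> c + 3"
        using that assms(2) by auto
      then show ?thesis
        using that by auto
    qed
  qed (use assms(1) in auto)
  then obtain x where x: "x \<in> ?X" "vtx n x = vtx n c"
    by blast
  \<comment> \<open>Because \<open>0 < x - c < 2 * n\<close>, the only possible multiple of
    \<open>n\<close> is \<open>n\<close> itself, which is odd, whereas \<open>x - c\<close> is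
    even.\<close>
  have "vtx n (x - int n) = vtx n c"
    using x(2) by (simp add: vtx_def)
  then have "x - int n = c"
  proof (rule vtx_eq_imp_eq)
    show "\<bar>x - int n - c\<bar> < int n"
      using x(1) e_bounds by simp linarith
  qed
  then have "x - c = int n"
    by simp
  with x(1) odd show False
    by (metis (mono_tags, lifting) mem_Collect_eq)
qed

text \<open>For \<open>2 * k = n - 1\<close> the two deleted windows of \<open>S_graph\<close>
  coincide, and the deleted frames fill a block of \<open>n\<close> consecutive indices, hence are
  all the frames.\<close>

lemma no_frames_eq_S_graph:
  assumes "\<And>i. \<not> has_frame i" "\<not> has_window c"
    and "2 * k = int n - 1" "vtx n (j - 2) = vtx n c"
  shows "G = S_graph n k j"
proof (rule eq_S_graphI)
  fix i
  have eq: "j + 2 * k - 1 = (j - 2) + int n"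
    using assms(3) by simp
  have "\<exists>t\<in>{j - 1..j + 2 * k - 1}. vtx n i = vtx n t"
  proof -
    obtain t where "vtx n t = vtx n i" "j - 1 \<le> t" "t < j - 1 + int n"
      using vtx_representative[of n i "j - 1"] n_ge by auto
    then show ?thesis
      using eq by (intro bexI[of _ t]) auto
  qed
  then show "has_frame i \<longleftrightarrow> (\<forall>t\<in>{j - 1..j + 2 * k - 1}. vtx n i \<noteq> vtx n t)"
    using assms(1) by blast
  have "vtx n (j + 2 * k - 1) = vtx n c"
    unfolding eq assms(4)[symmetric] by (simp add: vtx_def)
  then show "has_window i \<longleftrightarrow> vtx n i \<noteq> vtx n (j - 2) \<and> vtx n i \<noteq> vtx n (j + 2 * k - 1)"
    using no_frames_missing_window_unique[OF assms(1,2), of i] assms(2,4) has_window_cong[of i c]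
    by metis
qed

section \<open>The case with both present and missing frames\<close>

text \<open>The run starting at \<open>a\<close> begins at the index \<open>j - 1\<close> of
  \<open>S_graph\<close>, whence \<open>j = a + 1\<close>. All edges are examined through their
  indices in \<open>a, ..., a + n - 1\<close>.\<close>

lemma run_eq_S_graph:
  assumes "\<not> has_frame a" "has_frame (a - 1)"
  obtains k where "0 \<le> k" "2 * k \<le> int n - 2" "G = S_graph n k (a + 1)"
proof -
  \<comment> \<open>The present frame before the run recurs one period later and stops every run
    that starts within the period.\<close>
  have frame_end: "has_frame (a + int n - 1)"
    using assms(2) has_frame_period[of "a - 1"] by (simp add: algebra_simps)
  have run_end: "\<exists>b. a' \<le> b \<and> b \<le> a + int n - 2 \<and> has_frame (b + 1) \<and>
      (\<forall>i. a' \<le> i \<longrightarrow> i \<le> b \<longrightarrow> \<not> has_frame i)"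
    if a': "\<not> has_frame a'" "a' \<le> a + int n - 1" for a'
  proof -
    obtain d where "a' \<le> d" "d \<le> a + int n - 1" "has_frame d"
      "\<And>i. a' \<le> i \<Longrightarrow> i < d \<Longrightarrow> \<not> has_frame i"
      using int_first_satisfying[of has_frame, OF frame_end a'(2)] by blast
    moreover from this a' have "d \<noteq> a'"
      by auto
    ultimately show ?thesis
      by (intro exI[of _ "d - 1"]) auto
  qed
  obtain b where b: "a \<le> b" "b \<le> a + int n - 2" "has_frame (b + 1)"
    "\<And>i. a \<le> i \<Longrightarrow> i \<le> b \<Longrightarrow> \<not> has_frame i"
    using run_end[of a] assms n_ge by auto
  \<comment> \<open>The triangles \<open>a - 1\<close> and \<open>b\<close> each contain one present
    and one missing frame, so their windows are missing.\<close>
  have no_window: "\<not> has_window (a - 1)" "\<not> has_window b"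
    using triangle_closed(2)[of "a - 1"] triangle_closed(3)[of b] assms b by auto
  note run = run_even_and_windows[OF b(1,2,4) no_window]
  \<comment> \<open>A missing frame after \<open>b\<close> would lie in a second run; the first such
    frame is its start \<open>a'\<close>, and its end \<open>b'\<close> comes from
    \<open>run_end\<close>.\<close>
  have frames: "has_frame c" if c: "b + 1 \<le> c" "c \<le> a + int n - 1" for c
  proof (rule ccontr)
    assume "\<not> has_frame c"
    then obtain a' where a': "b + 1 \<le> a'" "a' \<le> c" "\<not> has_frame a'"
      "\<And>i. b + 1 \<le> i \<Longrightarrow> i < a' \<Longrightarrow> has_frame i"
      using int_first_satisfying[of "\<lambda>i. \<not> has_frame i" c "b + 1"] c by blast
    then have "a' \<noteq> b + 1"
      using b(3) by auto
    with a' have a'_ge: "b + 2 \<le> a'" "has_frame (a' - 1)"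
      by auto
    obtain b' where b': "a' \<le> b'" "b' \<le> a + int n - 2" "has_frame (b' + 1)"
      "\<And>i. a' \<le> i \<Longrightarrow> i \<le> b' \<Longrightarrow> \<not> has_frame i"
      using run_end[of a'] a' c by auto
    have no_window': "\<not> has_window (a' - 1)" "\<not> has_window b'"
      using triangle_closed(2)[of "a' - 1"] triangle_closed(3)[of b'] a' a'_ge b' by auto
    have "even (b' - a')"
      using b' no_window' a'_ge b(1) by (intro run_even_and_windows) auto
    then show False
      using no_two_runs[of a b a' b'] b b' a'_ge run no_window no_window' by blast
  qed
  have windows: "has_window i \<longleftrightarrow> i \<noteq> b \<and> i \<noteq> a + int n - 1"
    if i: "a \<le> i" "i \<le> a + int n - 1" for i
  proof -
    have "\<not> has_window (a + int n - 1)"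
      using no_window(1) has_window_period[of "a - 1"] by (simp add: algebra_simps)
    \<comment> \<open>Beyond the run both frames of the triangle are present.\<close>
    moreover have "has_window i" if "b < i" "i < a + int n - 1"
      using that by (intro triangle_closed(1) frames) auto
    ultimately show ?thesis
      using run(2)[of i] no_window(2) i by (cases i b rule: linorder_cases) auto
  qed
  define k where "k = (b - a) div 2"
  have k: "2 * k = b - a"
    using run(1) by (simp add: k_def)
  have "G = S_graph n k (a + 1)"
  proof (rule eq_S_graphI)
    fix i
    obtain i' where i': "vtx n i' = vtx n i" "a \<le> i'" "i' < a + int n"
      using vtx_representative[of n i a] n_ge by auto
    have eq_iff: "vtx n i = vtx n t \<longleftrightarrow> i' = t" if "a \<le> t" "t < a + int n" for t
      using i' that vtx_eq_imp_eq[of n i' t] by auto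
    have "has_frame i \<longleftrightarrow> b < i'"
      using i' has_frame_cong[of i' i] frames[of i'] b(4)[of i'] by force
    also have "\<dots> \<longleftrightarrow> (\<forall>t\<in>{a..b}. vtx n i \<noteq> vtx n t)"
      using eq_iff i' b(2) by auto
    finally show "has_frame i \<longleftrightarrow> (\<forall>t\<in>{a + 1 - 1..a + 1 + 2 * k - 1}. vtx n i \<noteq> vtx n t)"
      using k by simp
    have "vtx n (a + 1 - 2) = vtx n (a + int n - 1)"
      by (simp add: vtx_eq_iff)
    moreover have "a + 1 + 2 * k - 1 = b"
      using k by simp
    ultimately show "has_window i \<longleftrightarrow>
        vtx n i \<noteq> vtx n (a + 1 - 2) \<and> vtx n i \<noteq> vtx n (a + 1 + 2 * k - 1)"
      using windows[of i'] i' has_window_cong[of i' i] eq_iff b(1,2) n_ge by auto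
  qed
  with that[of k] k b show ?thesis
    by auto
qed

text \<open>Walking up from \<open>p\<close>, the first missing frame starts a run. It is moved into
  \<open>-1, ..., n - 2\<close> so that \<open>j = a + 1\<close> falls in the range required of
  \<open>j\<close>.\<close>

lemma exists_run_start:
  assumes "has_frame p" "\<not> has_frame q"
  obtains a where "\<not> has_frame a" "has_frame (a - 1)" "0 \<le> a + 1" "a + 1 \<le> int n - 1"
proof -
  have "n > 0"
    using n_ge by simp
  then obtain q' where q': "vtx n q' = vtx n q" "p \<le> q'"
    using vtx_representative[of n q p] by blast
  then have "\<not> has_frame q'"
    using assms(2) has_frame_cong by blast
  then obtain r where r: "p \<le> r" "\<not> has_frame r" "\<And>i. p \<le> i \<Longrightarrow> i < r \<Longrightarrow> has_frame i"
    using int_first_satisfying[of "\<lambda>i. \<not> has_frame i" q' p] q' by blast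
  then have "r \<noteq> p"
    using assms(1) by auto
  with r have "has_frame (r - 1)"
    by simp
  obtain a where a: "vtx n a = vtx n r" "-1 \<le> a" "a < -1 + int n"
    using vtx_representative[OF \<open>n > 0\<close>] by blast
  have "vtx n (a - 1) = vtx n (r - 1)"
    using a(1) by (simp add: vtx_eq_iff)
  with \<open>has_frame (r - 1)\<close> have "has_frame (a - 1)"
    using has_frame_cong by blast
  moreover have "\<not> has_frame a"
    using a(1) r(2) has_frame_cong by blast
  ultimately show ?thesis
    using that[of a] a(2,3) by simp
qed

end

theorem theorem3p4:
  fixes n :: nat and G :: "int pair_pre_digraph"
  assumes "n \<ge> 5"
    and "wcs_closed n G"
    and "\<not> trivial_wcs_closed n G"
  shows "\<exists>j k :: int. 0 \<le> j \<and> j \<le> int n - 1 \<and> 0 \<le> k \<and> k \<le> \<lceil>(real n - 2) / 2\<rceil> \<and>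
           G = S_graph n k j"
proof -
  interpret closed_spanning_subgraph n G
    using assms(1,2) by unfold_locales
  \<comment> \<open>Rounding up admits \<open>2 * k = n - 1\<close>, the value that arises when all
    frames are missing.\<close>
  have k_bound: "k \<le> \<lceil>(real n - 2) / 2\<rceil>" if "2 * k \<le> int n - 1" for k
    using that by (simp add: le_ceiling_iff field_simps)
  consider "\<And>i. has_frame i" | "\<And>i. \<not> has_frame i" | p q where "has_frame p" "\<not> has_frame q"
    by blast
  then show ?thesis
  proof cases
    case 1
    then have "G = square_cycle n"
      by (intro eq_square_cycleI triangle_closed(1))
    with assms(3) show ?thesis
      by (simp add: trivial_wcs_closed_def)
  next
    case 2
    then have "odd n"
      by (rule no_frames_odd)
    then obtain c where c: "\<not> has_window c"
      using eq_windows_graphI 2 assms(3) by (auto simp: trivial_wcs_closed_def)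
    from \<open>odd n\<close> obtain m where m: "n = 2 * m + 1"
      by (auto elim: oddE)
    \<comment> \<open>The shift by 2 makes the deleted window \<open>j - 2\<close> the missing
      window \<open>c\<close>.\<close>
    obtain j where j: "vtx n j = vtx n (c + 2)" "0 \<le> j" "j < 0 + int n"
      using vtx_representative[of n "c + 2" 0] n_ge by auto
    have "G = S_graph n (int m) j"
      using 2 c
    proof (rule no_frames_eq_S_graph)
      show "vtx n (j - 2) = vtx n c"
        using j(1) by (simp add: vtx_eq_iff algebra_simps)
    qed (use m in simp)
    with j m k_bound[of "int m"] show ?thesis
      by (intro exI[of _ j] exI[of _ "int m"]) auto
  next
    case 3
    then obtain a where a: "\<not> has_frame a" "has_frame (a - 1)" "0 \<le> a + 1" "a + 1 \<le> int n - 1"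
      by (rule exists_run_start)
    from a(1,2) obtain k where "0 \<le> k" "2 * k \<le> int n - 2" "G = S_graph n k (a + 1)"
      by (rule run_eq_S_graph)
    with a k_bound[of k] show ?thesis
      by (intro exI[of _ "a + 1"] exI[of _ k]) auto
  qed
qed

end
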